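(* Let $\theta>0$, let $\lambda_n=\frac12 n(n-1+\theta)$ for $n\ge 0$, and for $s>0$ let $d_m(s)$, $m=0,1,2,\ldots$, be the functions given explicitly in the context. For integers $0\le r\le n$ and $s>0$ let $P(D_{t+s}=r\mid D_t=n)$ denote the (time-homogeneous) transition probability over a time interval of length $s$ from state $n$ to state $r$ of the pure death process $D$ with death rates $\lambda_n$. Then for all integers $0\le r\le n$ and all $s>0$, $$\sum_{m=r}^{\infty}C(m,r)\,\frac{\theta_{(m)}}{\theta_{(n+m)}}\,d_m(s)=\frac{\theta_{(r)}\,(n-r)!}{\theta_{(n)}\,n!}\,P(D_{t+s}=r\mid D_t=n).$$
   Context: Notation: $a_{(k)}=a(a+1)\cdots(a+k-1)$ for $k\ge1$, $a_{(0)}=1$; $C(m,n)=\frac{m!}{(m-n)!\,n!}$. The pure death process with rates $\lambda_n$ is the continuous-time Markov chain on $\{0,1,2,\ldots\}$ which, from state $n\ge1$, waits an exponential time with parameter $\lambda_n$ and then jumps to $n-1$; state $0$ is absorbing ($\lambda_0=0$). The functions $d_n(t)$, $t>0$, are defined by $$d_n(t)=\sum_{m=n}^{\infty}(-1)^{m-n}\,C(m,n)\,(\theta+n)_{(m-1)}\,\frac{1}{m!}\,\gamma_{m,t,\theta}\qquad(n\ge1),$$ $$d_0(t)=1-\sum_{m=1}^{\infty}(-1)^{m-1}\,\theta_{(m-1)}\,\frac{1}{m!}\,\gamma_{m,t,\theta},$$ where $\gamma_{m,t,\theta}=(2m-1+\theta)\,e^{-\lambda_m t}$. (It is known that $d_n(t)=P(D_t=n)$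 for this death process started from $D_0=\infty$.) *)

theory Defs
  imports "HOL-Probability.Probability"
begin

definition death_rate :: "real \<Rightarrow> nat \<Rightarrow> real" where
  "death_rate \<theta> n = real n * (real n - 1 + \<theta>) / 2"

definition gamma_coeff :: "nat \<Rightarrow> real \<Rightarrow> real \<Rightarrow> real" where
  "gamma_coeff m t \<theta> = (2 * real m - 1 + \<theta>) * exp (- death_rate \<theta> m * t)"

(* The series index is k = m - n for n >= 1 and k = m - 1 for n = 0. *)
definition d_fun :: "real \<Rightarrow> nat \<Rightarrow> real \<Rightarrow> real" where
  "d_fun \<theta> n t =
    (if n = 0 then
       1 - (\<Sum>k. (-1) ^ k * pochhammer \<theta> k * (1 / fact (k + 1)) * gamma_coeff (k + 1) t \<theta>)
     else
       (\<Sum>k. (-1) ^ k * real ((n + k) choose n) * pochhammer (\<theta> + real n) (n + k - 1)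
             * (1 / fact (n + k)) * gamma_coeff (n + k) t \<theta>))"

(* The state at time t of the path that starts in n and, in each state k >= 1,
   waits for the time h k before jumping to k - 1. State 0 is absorbing. *)
fun death_path :: "(nat \<Rightarrow> real) \<Rightarrow> nat \<Rightarrow> real \<Rightarrow> nat" where
  "death_path h 0 t = 0"
| "death_path h (Suc n) t =
    (if t < h (Suc n) then Suc n else death_path h n (t - h (Suc n)))"

(* Each state is visited at most once, so one holding time T k per state k >= 1 suffices.
   The initial state has an arbitrary law; it enters the independent family as member 0,
   embedded into the reals because indep_vars needs a common value type. *)
definition pure_death_process ::
  "'a measure \<Rightarrow> (nat \<Rightarrow> real) \<Rightarrow> (real \<Rightarrow> 'a \<Rightarrow> nat) \<Rightarrow> bool" where
  "pure_death_process M rate D \<longleftrightarrow>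
     prob_space M \<and>
     (\<forall>t\<ge>0. D t \<in> measurable M (count_space UNIV)) \<and>
     (\<exists>T :: nat \<Rightarrow> 'a \<Rightarrow> real.
        prob_space.indep_vars M (\<lambda>_. borel)
          (\<lambda>k. if k = 0 then (\<lambda>\<omega>. real (D 0 \<omega>)) else T k) UNIV \<and>
        (\<forall>k\<ge>1. distributed M lborel (T k) (exponential_density (rate k))) \<and>
        (AE \<omega> in M. \<forall>t\<ge>0. D t \<omega> = death_path (\<lambda>k. T k \<omega>) (D 0 \<omega>) t))"

end

(* The transition probabilities of a pure death chain with distinct rates are the explicit
   exponential sums obtained by partial fractions; they follow by induction on the starting
   state, conditioning on the first holding time. On the other side, the double series obtained
   by inserting d_m is absolutely convergent, so it may be summed over m first. For fixed
   exponent k the inner sum is a (k-r)-th finite difference: for k > n of a polynomial of degree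
   k-1-n < k-r, hence 0; for k <= n of the reciprocal of a rising factorial, which has a closed
   form. The remaining terms r <= k <= n agree one by one with those of the transition
   probability. *)
theory Submission
  imports Defs "HOL-Real_Asymp.Real_Asymp"
begin

subsection \<open>Transition functions of a death chain with distinct rates\<close>

text \<open>The process is given by holding times alone, so its Markov property has to be derived.
  The induction therefore treats the joint law of a path at the two times t and t + s; the product
  form of that law yields the Markov property and the transition function at once.

  Finite differences arise as follows. With a = \<theta>, a_(m) (a+m)_(k-1) = a_(m+k-1). Division by
  a_(n+m) leaves k-1-n consecutive factors in the numerator if k > n, and n-k+1 in the denominator
  otherwise. The two binomials merge into C(k,r) C(k-r,m-r), which with the signs of d_m are the
  weights of a difference of order k-r in m.

  Absolute convergence is a matter of growth: the coefficients are at most of order k^k up to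
  geometric and polynomial factors, while \<lambda>_k is quadratic in k, so exp(-\<lambda>_k s) wins
  for every s > 0.

  The final match works because \<lambda>_j - \<lambda>_k = (j-k)(j+k-1+\<theta>)/2: the factor
  2k-1+\<theta> of \<gamma> is exactly the value of j+k-1+\<theta> at the omitted index j =
  k.\<close>

definition death_trans :: "(nat \<Rightarrow> real) \<Rightarrow> nat \<Rightarrow> nat \<Rightarrow> real \<Rightarrow> real" where
  "death_trans rate n r t = (\<Prod>i\<in>{r<..n}. rate i) *
     (\<Sum>k\<in>{r..n}. exp (- rate k * t) / (\<Prod>j\<in>{r..n} - {k}. rate j - rate k))"

text \<open>This is the partial fraction expansion of the reciprocal of a polynomial with simple
  roots, read as a function of \<open>y\<close>. A new node \<open>a\<close> splits each summand
  into a difference of two, so the induction hypothesis is applied twice, at \<open>x a\<close> and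
  at \<open>y\<close>; hence \<open>y\<close> is arbitrary.\<close>

lemma partial_fractions_at_point:
  fixes x :: "'i \<Rightarrow> 'b :: field"
  assumes "finite A" "A \<noteq> {}" "inj_on x A" "y \<notin> x ` A"
  shows "(\<Sum>k\<in>A. 1 / ((y - x k) * (\<Prod>j\<in>A - {k}. x j - x k))) = - (1 / (\<Prod>j\<in>A. x j - y))"
  using assms
proof (induction A arbitrary: y rule: finite_ne_induct)
  case (singleton a)
  then show ?case by (simp add: field_simps)
next
  case (insert a A)
  define W where "W = (\<lambda>k. \<Prod>j\<in>A - {k}. x j - x k)"
  have inj: "inj_on x A" and a: "x a \<notin> x ` A" and y: "y \<notin> x ` A" "y \<noteq> x a"
    using insert.prems insert.hyps by (auto simp: inj_on_def)
  have step: "1 / ((y - x k) * (\<Prod>j\<in>insert a A - {k}. x j - x k))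
      = (1 / ((x a - x k) * W k) - 1 / ((y - x k) * W k)) / (y - x a)" if "k \<in> A" for k
  proof -
    have "insert a A - {k} = insert a (A - {k})" using that insert.hyps by auto
    hence P: "(\<Prod>j\<in>insert a A - {k}. x j - x k) = (x a - x k) * W k"
      unfolding W_def using insert.hyps by simp
    have nz: "x a - x k \<noteq> 0" "y - x k \<noteq> 0" "y - x a \<noteq> 0" "W k \<noteq> 0"
      using a y that insert.hyps inj by (auto simp: W_def inj_on_def)
    show ?thesis unfolding P using nz by (simp add: divide_simps)
  qed
  have "insert a A - {a} = A" using insert.hyps by auto
  hence "(\<Sum>k\<in>insert a A. 1 / ((y - x k) * (\<Prod>j\<in>insert a A - {k}. x j - x k)))
      = 1 / ((y - x a) * (\<Prod>j\<in>A. x j - x a))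
        + (\<Sum>k\<in>A. (1 / ((x a - x k) * W k) - 1 / ((y - x k) * W k)) / (y - x a))"
    using insert.hyps step by simp
  also have "(\<Sum>k\<in>A. (1 / ((x a - x k) * W k) - 1 / ((y - x k) * W k)) / (y - x a))
      = ((\<Sum>k\<in>A. 1 / ((x a - x k) * W k)) - (\<Sum>k\<in>A. 1 / ((y - x k) * W k))) / (y - x a)"
    by (simp only: sum_divide_distrib[symmetric] sum_subtractf)
  also have "\<dots> = (1 / (\<Prod>j\<in>A. x j - y) - 1 / (\<Prod>j\<in>A. x j - x a)) / (y - x a)"
    unfolding W_def using insert.IH[OF inj a] insert.IH[OF inj y(1)] by simp
  also have "1 / ((y - x a) * (\<Prod>j\<in>A. x j - x a)) + \<dots> = - (1 / (\<Prod>j\<in>insert a A. x j - y))"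
  proof -
    have nz: "y - x a \<noteq> 0" "x a - y \<noteq> 0" "(\<Prod>j\<in>A. x j - x a) \<noteq> 0" "(\<Prod>j\<in>A. x j - y) \<noteq> 0"
      using a y insert.hyps by (auto simp: image_iff)
    have "(\<Prod>j\<in>insert a A. x j - y) = (x a - y) * (\<Prod>j\<in>A. x j - y)" using insert.hyps by simp
    then show ?thesis using nz by (simp add: divide_simps)
  qed
  finally show ?case .
qed

text \<open>Up to sign this is the divided difference of the constant 1. Taking one node out of
  \<open>A\<close> and using it as the evaluation point of the partial fractions turns the remaining
  sum into minus the term of that node.\<close>

lemma sum_inverse_prod_differences:
  fixes x :: "'i \<Rightarrow> 'b :: field"
  assumes "finite A" "card A \<ge> 2" "inj_on x A"
  shows "(\<Sum>k\<in>A. 1 / (\<Prod>j\<in>A - {k}. x j - x k)) = 0"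
proof -
  obtain a where a: "a \<in> A" using assms(2) by fastforce
  define B where "B = A - {a}"
  have B: "finite B" "a \<notin> B" "A = insert a B" "inj_on x B" "x a \<notin> x ` B"
    using assms a by (auto simp: B_def inj_on_def)
  have "B \<noteq> {}" using B(3) assms(2) by auto
  have "(\<Sum>k\<in>B. 1 / (\<Prod>j\<in>A - {k}. x j - x k)) = (\<Sum>k\<in>B. 1 / ((x a - x k) * (\<Prod>j\<in>B - {k}. x j - x k)))"
  proof (rule sum.cong)
    fix k assume "k \<in> B"
    hence "A - {k} = insert a (B - {k})" using B by auto
    then show "1 / (\<Prod>j\<in>A - {k}. x j - x k) = 1 / ((x a - x k) * (\<Prod>j\<in>B - {k}. x j - x k))"
      using B by simp
  qed simp
  then show ?thesis
    using partial_fractions_at_point[OF B(1) \<open>B \<noteq> {}\<close> B(4,5)] B by (simp add: insert_Diff_if)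
qed

lemma death_trans_self [simp]: "death_trans rate n n t = exp (- rate n * t)"
  by (simp add: death_trans_def)

lemma death_trans_eq_0: "n < r \<Longrightarrow> death_trans rate n r t = 0"
  by (simp add: death_trans_def)

lemma death_trans_at_0:
  assumes "inj rate" "r < n"
  shows "death_trans rate n r 0 = 0"
  using sum_inverse_prod_differences[of "{r..n}" rate] assms
  by (simp add: death_trans_def inj_on_def)

text \<open>Kolmogorov's backward equation. Adding \<open>rate (Suc n)\<close> times the function to
  its derivative puts a factor \<open>rate (Suc n) - rate k\<close> on each exponential: it kills
  the term \<open>k = Suc n\<close> and cancels one denominator factor in all others.\<close>

lemma death_trans_has_derivative:
  assumes "inj rate" "r \<le> n"
  shows "(death_trans rate (Suc n) r has_real_derivative
           rate (Suc n) * (death_trans rate n r t - death_trans rate (Suc n) r t)) (at t)"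
proof -
  define P where "P = (\<Prod>i\<in>{r<..Suc n}. rate i)"
  define W where "W = (\<lambda>k. \<Prod>j\<in>{r..Suc n} - {k}. rate j - rate k)"
  have "{r<..Suc n} = insert (Suc n) {r<..n}" using assms by auto
  hence P: "P = rate (Suc n) * (\<Prod>i\<in>{r<..n}. rate i)"
    by (simp add: P_def)
  have "rate (Suc n) * (P * (\<Sum>k\<in>{r..Suc n}. exp (- rate k * t) / W k))
       + P * (\<Sum>k\<in>{r..Suc n}. - rate k * exp (- rate k * t) / W k)
      = P * (\<Sum>k\<in>{r..Suc n}. (rate (Suc n) - rate k) * exp (- rate k * t) / W k)"
    by (simp add: algebra_simps sum_distrib_left sum.distrib sum_subtractf diff_divide_distrib sum_negf)
  also have "(\<Sum>k\<in>{r..Suc n}. (rate (Suc n) - rate k) * exp (- rate k * t) / W k)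
      = (\<Sum>k\<in>{r..n}. (rate (Suc n) - rate k) * exp (- rate k * t) / W k)"
    using assms by simp
  also have "\<dots> = (\<Sum>k\<in>{r..n}. exp (- rate k * t) / (\<Prod>j\<in>{r..n} - {k}. rate j - rate k))"
  proof (rule sum.cong)
    fix k assume k: "k \<in> {r..n}"
    hence "{r..Suc n} - {k} = insert (Suc n) ({r..n} - {k})" by auto
    hence "W k = (rate (Suc n) - rate k) * (\<Prod>j\<in>{r..n} - {k}. rate j - rate k)"
      by (simp add: W_def)
    moreover have "rate (Suc n) - rate k \<noteq> 0" using k assms by (auto simp: inj_eq)
    ultimately show "(rate (Suc n) - rate k) * exp (- rate k * t) / W k
      = exp (- rate k * t) / (\<Prod>j\<in>{r..n} - {k}. rate j - rate k)" by simp
  qed simp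
  finally have sum_eq: "rate (Suc n) * (P * (\<Sum>k\<in>{r..Suc n}. exp (- rate k * t) / W k))
       + P * (\<Sum>k\<in>{r..Suc n}. - rate k * exp (- rate k * t) / W k)
     = P * (\<Sum>k\<in>{r..n}. exp (- rate k * t) / (\<Prod>j\<in>{r..n} - {k}. rate j - rate k))" .
  have eq: "P * (\<Sum>k\<in>{r..Suc n}. - rate k * exp (- rate k * t) / W k)
      = rate (Suc n) * (death_trans rate n r t - death_trans rate (Suc n) r t)"
  proof -
    have "death_trans rate (Suc n) r t = P * (\<Sum>k\<in>{r..Suc n}. exp (- rate k * t) / W k)"
      by (simp only: death_trans_def P_def W_def)
    moreover have "rate (Suc n) * death_trans rate n r t
        = P * (\<Sum>k\<in>{r..n}. exp (- rate k * t) / (\<Prod>j\<in>{r..n} - {k}. rate j - rate k))"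
      by (simp only: death_trans_def P mult.assoc)
    ultimately show ?thesis
      using sum_eq by (simp only: right_diff_distrib)
  qed
  have "((\<lambda>t. P * (\<Sum>k\<in>{r..Suc n}. exp (- rate k * t) / W k)) has_real_derivative
      P * (\<Sum>k\<in>{r..Suc n}. - rate k * exp (- rate k * t) / W k)) (at t)"
    by (intro DERIV_cmult DERIV_sum DERIV_cdivide) (auto intro!: derivative_eq_intros)
  then show ?thesis
    unfolding eq by (simp add: death_trans_def[abs_def] P_def W_def)
qed

text \<open>Convolving a transition function with the exponential density of the holding time in
  state \<open>n + 1\<close> is explicit because of this primitive.\<close>

lemma death_trans_primitive:
  assumes "inj rate" "r \<le> n"
  shows "((\<lambda>u. - (exp (- u * rate (Suc n)) * death_trans rate (Suc n) r (b - u))) has_real_derivative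
           rate (Suc n) * exp (- u * rate (Suc n)) * death_trans rate n r (b - u)) (at u)"
  by (rule derivative_eq_intros DERIV_chain2[OF death_trans_has_derivative[OF assms]] refl)+
     (simp add: algebra_simps)

text \<open>The sum has mixed signs, so positivity is not visible in the formula. By induction the
  primitive \<open>?F\<close> is nondecreasing on [0, t]; it starts at minus the value in question
  and ends at 0 because of \<open>death_trans_at_0\<close>. Positivity is what lets these values
  pass through \<open>ennreal\<close>.\<close>

lemma death_trans_nonneg:
  assumes "inj rate" "\<And>k. k \<ge> 1 \<Longrightarrow> rate k \<ge> 0" "t \<ge> 0"
  shows "death_trans rate n r t \<ge> 0"
  using assms(3)
proof (induction n arbitrary: t)
  case 0
  show ?case by (cases "r = 0") (simp_all add: death_trans_eq_0)
next
  case (Suc n)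
  let ?F = "\<lambda>u. - (exp (- u * rate (Suc n)) * death_trans rate (Suc n) r (t - u))"
  consider "r \<le> n" | "r = Suc n" | "Suc n < r" by linarith
  then show ?case
  proof cases
    case 1
    have "?F 0 \<le> ?F t"
    proof (rule DERIV_nonneg_imp_nondecreasing[OF Suc.prems])
      fix u assume "0 \<le> u" "u \<le> t"
      then show "\<exists>y. (?F has_real_derivative y) (at u) \<and> 0 \<le> y"
        using death_trans_primitive[OF assms(1) 1] Suc.IH[of "t - u"] assms(2)[of "Suc n"] by force
    qed
    then show ?thesis using death_trans_at_0[OF assms(1), of r "Suc n"] 1 by simp
  qed (simp_all add: death_trans_eq_0)
qed

text \<open>The lower limit \<open>a\<close> is free because two ranges of the first holding time
  occur: from 0 to t if the initial state has been left by time t, and from t to t + s if it is left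
  in between. In the second case the factor at \<open>a\<close> is the probability of still waiting
  at time t.\<close>

lemma death_trans_nn_integral:
  assumes "inj rate" "\<And>k. k \<ge> 1 \<Longrightarrow> rate k \<ge> 0" "r \<le> n" "a \<le> b"
  shows "(\<integral>\<^sup>+u. ennreal (rate (Suc n) * exp (- u * rate (Suc n)) * death_trans rate n r (b - u))
            * indicator {a..b} u \<partial>lborel)
       = ennreal (exp (- rate (Suc n) * a) * death_trans rate (Suc n) r (b - a))"
proof -
  let ?l = "rate (Suc n)"
  let ?F = "\<lambda>u. - (exp (- u * ?l) * death_trans rate (Suc n) r (b - u))"
  have m: "(\<lambda>u. ?l * exp (- u * ?l) * death_trans rate n r (b - u)) \<in> borel_measurable borel"
    unfolding death_trans_def by measurable
  have "(\<integral>\<^sup>+u. ennreal (?l * exp (- u * ?l) * death_trans rate n r (b - u))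
            * indicator {a..b} u \<partial>lborel) = ennreal (?F b - ?F a)"
  proof (rule nn_integral_FTC_Icc[OF m, where F = ?F])
    fix u assume u: "u \<in> {a..b}"
    show "(?F has_real_derivative ?l * exp (- u * ?l) * death_trans rate n r (b - u)) (at u)"
      by (rule death_trans_primitive[OF assms(1,3)])
    show "0 \<le> ?l * exp (- u * ?l) * death_trans rate n r (b - u)"
      using u assms(2)[of "Suc n"] death_trans_nonneg[OF assms(1,2), of "b - u" n r]
      by simp
  qed (rule assms(4))
  also have "?F b - ?F a = exp (- ?l * a) * death_trans rate (Suc n) r (b - a)"
    using assms by (simp add: death_trans_at_0 mult.commute)
  finally show ?thesis .
qed

section \<open>Paths as functions of the holding times, and their law at two times\<close>

lemma death_path_cong:
  assumes "\<And>i. Suc 0 \<le> i \<Longrightarrow> i \<le> N \<Longrightarrow> f i = g i"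
  shows "death_path f N t = death_path g N t"
  using assms
proof (induction N arbitrary: t)
  case (Suc N)
  have "f (Suc N) = g (Suc N)" by (rule Suc.prems) auto
  moreover have "death_path f N u = death_path g N u" for u
    by (rule Suc.IH) (rule Suc.prems, auto)
  ultimately show ?case by simp
qed simp

text \<open>Lets a path be viewed as a function on a finite product space, the form in which
  independence of the holding times is applied.\<close>

lemma death_path_restrict: "death_path (restrict h {Suc 0..N}) N t = death_path h N t"
  by (rule death_path_cong) simp

lemma death_path_le: "death_path h N t \<le> N"
  by (induction N arbitrary: t) (auto intro: le_SucI)

text \<open>The product space keeps its index bound \<open>K\<close> while the recursion lowers
  \<open>N\<close>. The time \<open>g\<close> is a function because each jump subtracts a random
  holding time from it.\<close>

lemma measurable_death_path [measurable (raw)]: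
  assumes "f \<in> measurable M (PiM {Suc 0..K} (\<lambda>_. borel))" "N \<le> K" "g \<in> borel_measurable M"
  shows "(\<lambda>x. death_path (f x) N (g x)) \<in> measurable M (count_space UNIV)"
  using assms(2,3)
proof (induction N arbitrary: g)
  case (Suc N)
  have [measurable]: "(\<lambda>x. f x (Suc N)) \<in> borel_measurable M"
    by (rule measurable_component_singleton[THEN measurable_compose_rev, OF _ assms(1)])
       (use Suc.prems in auto)
  note Suc.prems(2)[measurable]
  have [measurable]: "(\<lambda>x. death_path (f x) N (g x - f x (Suc N))) \<in> measurable M (count_space UNIV)"
    by (rule Suc.IH) (use Suc.prems in auto)
  show ?case by simp
qed simp

text \<open>The detour through \<open>X\<close> and \<open>f\<close> is due to \<open>indep_var\<close>, which forces both variables to have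
  the same value type.\<close>

lemma (in prob_space) emeasure_indep_density:
  fixes f :: "'b \<Rightarrow> real"
  assumes indep: "indep_var S' X S Y"
    and f [measurable]: "f \<in> borel_measurable S'"
    and X: "distributed M lborel (\<lambda>\<omega>. f (X \<omega>)) g"
    and P: "Measurable.pred (borel \<Otimes>\<^sub>M S) (\<lambda>z. P (fst z) (snd z))"
  shows "emeasure M {\<omega> \<in> space M. P (f (X \<omega>)) (Y \<omega>)}
       = (\<integral>\<^sup>+x. g x * emeasure M {\<omega> \<in> space M. P x (Y \<omega>)} \<partial>lborel)"
proof -
  have rv [measurable]: "random_variable S' X" "random_variable S Y"
    using indep by (auto dest: indep_var_rv1 indep_var_rv2)
  note spc = measurable_space[OF rv(1)] measurable_space[OF rv(2)]
  interpret Y: prob_space "distr M S Y" by (rule prob_space_distr) simp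
  define A where "A = {z \<in> space (borel \<Otimes>\<^sub>M S). P (fst z) (snd z)}"
  define B where "B = {z \<in> space (S' \<Otimes>\<^sub>M S). P (f (fst z)) (snd z)}"
  define h where "h = (\<lambda>x. emeasure M {\<omega> \<in> space M. P x (Y \<omega>)})"
  have A: "A \<in> sets (borel \<Otimes>\<^sub>M S)" using P by (simp add: A_def pred_def)
  have "(\<lambda>z. (f (fst z), snd z)) \<in> measurable (S' \<Otimes>\<^sub>M S) (borel \<Otimes>\<^sub>M S)" by measurable
  from measurable_sets[OF this A]
  have B: "B \<in> sets (S' \<Otimes>\<^sub>M S)"
    by (rule back_subst[where P = "\<lambda>B. B \<in> _"])
       (auto simp: A_def B_def space_pair_measure)
  have hA: "emeasure (distr M S Y) (Pair x -` A) = h x" for x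
    unfolding h_def using sets_Pair1[OF A, of x] spc
    by (subst emeasure_distr)
       (auto simp: A_def space_pair_measure intro!: arg_cong[where f = "emeasure M"])
  have hB: "emeasure (distr M S Y) (Pair x -` B) = h (f x)" if "x \<in> space S'" for x
    unfolding h_def using sets_Pair1[OF B, of x] spc that
    by (subst emeasure_distr)
       (auto simp: B_def space_pair_measure intro!: arg_cong[where f = "emeasure M"])
  have h [measurable]: "h \<in> borel_measurable borel"
    unfolding hA[symmetric] using Y.measurable_emeasure_Pair[of A borel] A by simp
  have "emeasure M {\<omega> \<in> space M. P (f (X \<omega>)) (Y \<omega>)}
      = emeasure (distr M (S' \<Otimes>\<^sub>M S) (\<lambda>\<omega>. (X \<omega>, Y \<omega>))) B"
    using B spc by (subst emeasure_distr)
       (auto simp: B_def space_pair_measure intro!: arg_cong[where f = "emeasure M"])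
  also have "\<dots> = emeasure (distr M S' X \<Otimes>\<^sub>M distr M S Y) B"
    using indep by (simp add: indep_var_distribution_eq)
  also have "\<dots> = (\<integral>\<^sup>+x. emeasure (distr M S Y) (Pair x -` B) \<partial>distr M S' X)"
    by (rule Y.emeasure_pair_measure_alt) (use B in simp)
  also have "\<dots> = (\<integral>\<^sup>+x. h (f x) \<partial>distr M S' X)"
    by (rule nn_integral_cong) (simp add: hB)
  also have "\<dots> = (\<integral>\<^sup>+x. h x \<partial>distr M lborel (\<lambda>\<omega>. f (X \<omega>)))"
    by (simp add: nn_integral_distr)
  also have "distr M lborel (\<lambda>\<omega>. f (X \<omega>)) = density lborel g"
    using X by (simp add: distributed_def)
  also have "(\<integral>\<^sup>+x. h x \<partial>density lborel g) = (\<integral>\<^sup>+x. g x * h x \<partial>lborel)"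
    using X by (intro nn_integral_density) (auto simp: distributed_def)
  finally show ?thesis by (simp add: h_def)
qed

text \<open>Holding times only; the random initial state is added back in
  \<open>pure_death_process_transition\<close>. Setting \<open>rate 0 = 0\<close> makes
  \<open>death_trans rate 0 0 t\<close> equal to 1, so absorption fits the general formula.\<close>

locale death_chain = prob_space +
  fixes rate :: "nat \<Rightarrow> real" and T :: "nat \<Rightarrow> 'a \<Rightarrow> real"
  assumes inj_rate: "inj rate" and rate_0: "rate 0 = 0" and rate_pos: "k \<ge> 1 \<Longrightarrow> rate k > 0"
    and indep_T: "indep_vars (\<lambda>_. borel) T {1..}"
    and distr_T: "k \<ge> 1 \<Longrightarrow> distributed M lborel (T k) (exponential_density (rate k))"
begin

text \<open>Conditioning on the first holding time. By \<open>dep\<close> the event sees only the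
  holding times of lower states besides \<open>T (Suc N)\<close>, and these are independent of
  it.\<close>

lemma emeasure_path_Suc:
  assumes P: "Measurable.pred (borel \<Otimes>\<^sub>M PiM {Suc 0..N} (\<lambda>_. borel)) (\<lambda>z. P (fst z) (snd z))"
    and dep: "\<And>x h. P x (restrict h {Suc 0..N}) = P x h"
  shows "emeasure M {\<omega> \<in> space M. P (T (Suc N) \<omega>) (\<lambda>k. T k \<omega>)}
       = (\<integral>\<^sup>+u. ennreal (rate (Suc N) * exp (- u * rate (Suc N))) * indicator {0..} u
            * emeasure M {\<omega> \<in> space M. P u (\<lambda>k. T k \<omega>)} \<partial>lborel)"
proof -
  have indep: "indep_var (PiM {Suc N} (\<lambda>_. borel)) (\<lambda>\<omega>. restrict (\<lambda>i. T i \<omega>) {Suc N})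
      (PiM {Suc 0..N} (\<lambda>_. borel)) (\<lambda>\<omega>. restrict (\<lambda>i. T i \<omega>) {Suc 0..N})"
    by (rule indep_var_restrict[OF indep_T]) auto
  have "emeasure M {\<omega> \<in> space M. P (restrict (\<lambda>i. T i \<omega>) {Suc N} (Suc N)) (restrict (\<lambda>i. T i \<omega>) {Suc 0..N})}
      = (\<integral>\<^sup>+u. exponential_density (rate (Suc N)) u
            * emeasure M {\<omega> \<in> space M. P u (restrict (\<lambda>i. T i \<omega>) {Suc 0..N})} \<partial>lborel)"
    by (rule emeasure_indep_density[OF indep _ _ P]) (use distr_T[of "Suc N"] in simp_all)
  also have "\<dots> = (\<integral>\<^sup>+u. ennreal (rate (Suc N) * exp (- u * rate (Suc N))) * indicator {0..} u
            * emeasure M {\<omega> \<in> space M. P u (restrict (\<lambda>i. T i \<omega>) {Suc 0..N})} \<partial>lborel)"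
    by (intro nn_integral_cong) (auto simp: exponential_density_def split: split_indicator)
  finally show ?thesis by (simp add: dep)
qed

lemma death_path_pair_sets:
  "{\<omega> \<in> space M. death_path (\<lambda>k. T k \<omega>) N t = n \<and> death_path (\<lambda>k. T k \<omega>) N u = r} \<in> events"
proof -
  have T: "(\<lambda>\<omega>. restrict (\<lambda>k. T k \<omega>) {Suc 0..N}) \<in> measurable M (PiM {Suc 0..N} (\<lambda>_. borel))"
    using indep_T by (intro measurable_restrict) (auto simp: indep_vars_def)
  have [measurable]: "(\<lambda>\<omega>. death_path (\<lambda>k. T k \<omega>) N t) \<in> measurable M (count_space UNIV)" for t
    using measurable_death_path[OF T, of N "\<lambda>_. t"] by (simp add: death_path_restrict)
  show ?thesis by measurable
qed

text \<open>The second factor does not involve \<open>N\<close> or \<open>t\<close>: this is the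
  Markov property. After the first jump at time u the path is one started in \<open>N\<close> with
  both times shortened by u, which is where the induction hypothesis applies.\<close>

lemma emeasure_death_path_pair:
  assumes "t \<ge> 0" "s \<ge> 0"
  shows "emeasure M {\<omega> \<in> space M. death_path (\<lambda>k. T k \<omega>) N t = n \<and> death_path (\<lambda>k. T k \<omega>) N (t + s) = r}
       = ennreal (death_trans rate N n t * death_trans rate n r s)"
  using assms
proof (induction N arbitrary: t s n r)
  case 0
  then show ?case
    by (cases "n = 0"; cases "r = 0") (auto simp: rate_0 death_trans_eq_0 emeasure_space_1)
next
  case (Suc N)
  let ?l = "rate (Suc N)" and ?p = "\<lambda>\<omega>. death_path (\<lambda>k. T k \<omega>)"
  let ?E = "\<lambda>u. emeasure M {\<omega> \<in> space M. (if t < u then Suc N else ?p \<omega> N (t - u)) = n \<and>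
                  (if t + s < u then Suc N else ?p \<omega> N (t + s - u)) = r}"
  have l: "?l > 0" "k \<ge> 1 \<Longrightarrow> rate k \<ge> 0" for k using rate_pos[of k] rate_pos[of "Suc N"] by auto
  note nonneg = death_trans_nonneg[OF inj_rate l(2)]
  have eq: "emeasure M {\<omega> \<in> space M. ?p \<omega> (Suc N) t = n \<and> ?p \<omega> (Suc N) (t + s) = r}
     = (\<integral>\<^sup>+u. ennreal (?l * exp (- u * ?l)) * indicator {0..} u * ?E u \<partial>lborel)"
  proof -
    let ?P = "\<lambda>u h. (if t < u then Suc N else death_path h N (t - u)) = n \<and>
                  (if t + s < u then Suc N else death_path h N (t + s - u)) = r"
    have [measurable]: "(\<lambda>z. death_path (snd z) N (x - fst z))
        \<in> measurable (borel \<Otimes>\<^sub>M PiM {Suc 0..N} (\<lambda>_. borel)) (count_space UNIV)" for x :: real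
      by (rule measurable_death_path[where K = N]) auto
    have "emeasure M {\<omega> \<in> space M. ?P (T (Suc N) \<omega>) (\<lambda>k. T k \<omega>)}
       = (\<integral>\<^sup>+u. ennreal (?l * exp (- u * ?l)) * indicator {0..} u
            * emeasure M {\<omega> \<in> space M. ?P u (\<lambda>k. T k \<omega>)} \<partial>lborel)"
      by (rule emeasure_path_Suc) (measurable, simp add: death_path_restrict)
    then show ?thesis by simp
  qed
  consider "n \<le> N" | "n = Suc N" "r \<le> N" | "n = Suc N" "r = Suc N" | "n = Suc N" "r > Suc N" | "n > Suc N"
    by linarith
  then show ?case
  proof cases
    case 1
    \<comment> \<open>The state at time t is below the initial one, so only u in [0, t] contributes;
      there the second factor is constant in u and leaves the integral.\<close>
    have "ennreal (?l * exp (- u * ?l)) * indicator {0..} u * ?E u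
      = ennreal (?l * exp (- u * ?l) * death_trans rate N n (t - u)) * indicator {0..t} u
        * ennreal (death_trans rate n r s)" for u
    proof (cases "0 \<le> u \<and> u \<le> t")
      case True
      then have "?E u = ennreal (death_trans rate N n (t - u) * death_trans rate n r s)"
        using Suc.IH[of "t - u" s n r] Suc.prems by (simp add: algebra_simps)
      then show ?thesis using True l Suc.prems nonneg[of "t - u" N n] nonneg[of s n r]
        by (simp add: mult.assoc flip: ennreal_mult)
    qed (use 1 in auto)
    hence "(\<integral>\<^sup>+u. ennreal (?l * exp (- u * ?l)) * indicator {0..} u * ?E u \<partial>lborel)
      = (\<integral>\<^sup>+u. ennreal (?l * exp (- u * ?l) * death_trans rate N n (t - u)) * indicator {0..t} u \<partial>lborel)
        * ennreal (death_trans rate n r s)"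
      by (subst nn_integral_multc[symmetric]) (simp_all add: death_trans_def)
    then show ?thesis unfolding eq
      using death_trans_nn_integral[OF inj_rate l(2) 1, of 0 t] Suc.prems nonneg[of t "Suc N" n]
      by (simp add: ennreal_mult')
  next
    case 2
    \<comment> \<open>At u = t the path has just jumped, so the left side is 0 while the right side
      need not be; this single point is discarded as a null set.\<close>
    have "AE u in lborel. ennreal (?l * exp (- u * ?l)) * indicator {0..} u * ?E u
      = ennreal (?l * exp (- u * ?l) * death_trans rate N r (t + s - u)) * indicator {t..t + s} u"
      using AE_lborel_singleton[of t]
    proof eventually_elim
      case (elim u)
      show ?case
      proof (cases "t \<le> u \<and> u \<le> t + s")
        case True
        then have "?E u = ennreal (death_trans rate N r (t + s - u))"
          \<comment> \<open>With increment 0 and equal states the two-time law reduces to the law at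
            one time, since \<open>death_trans rate r r 0\<close> is 1.\<close>
          using Suc.IH[of "t + s - u" 0 r r] elim 2 by simp
        then show ?thesis using True l Suc.prems nonneg[of "t + s - u" N r]
          by (simp flip: ennreal_mult)
      next
        case False
        have "death_path h N x \<noteq> Suc N" for h x using death_path_le[of h N x] by simp
        then show ?thesis using False 2 Suc.prems by (auto split: split_indicator)
      qed
    qed
    hence "(\<integral>\<^sup>+u. ennreal (?l * exp (- u * ?l)) * indicator {0..} u * ?E u \<partial>lborel)
      = ennreal (exp (- ?l * t) * death_trans rate (Suc N) r s)"
      using death_trans_nn_integral[OF inj_rate l(2) 2(2), of t "t + s"] Suc.prems
      by (simp add: nn_integral_cong_AE)
    then show ?thesis unfolding eq using 2 by simp
  next
    case 3
    have "death_path h N x \<noteq> Suc N" for h x using death_path_le[of h N x] by simp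
    hence "{\<omega> \<in> space M. ?p \<omega> (Suc N) t = n \<and> ?p \<omega> (Suc N) (t + s) = r}
        = {\<omega> \<in> space M. t + s < T (Suc N) \<omega>}"
      using 3 Suc.prems by auto
    also have "emeasure M \<dots> = ennreal (exp (- (t + s) * ?l))"
      using exponential_distributedD_gt[OF distr_T[of "Suc N"], of "t + s"] l Suc.prems
      by (simp add: emeasure_eq_measure)
    \<comment> \<open>Memorylessness of the exponential law, in the case where no jump has happened
      by t + s.\<close>
    also have "exp (- (t + s) * ?l) = exp (- ?l * t) * exp (- ?l * s)"
      by (simp add: algebra_simps flip: exp_add)
    finally show ?thesis using 3 by simp
  next
    case 4
    have "death_path h (Suc N) x \<noteq> r" for h x using death_path_le[of h "Suc N" x] 4 by linarith
    then show ?thesis using 4 by (simp add: death_trans_eq_0 del: death_path.simps)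
  next
    case 5
    have "death_path h (Suc N) x \<noteq> n" for h x using death_path_le[of h "Suc N" x] 5 by linarith
    then show ?thesis using 5 by (simp add: death_trans_eq_0 del: death_path.simps)
  qed
qed

end

text \<open>The event is split by the initial state. Each part factors by independence of
  \<open>D 0\<close> from the holding times, and the factor \<open>death_trans rate n r s\<close> is
  common to all parts. The product form avoids conditioning on a null event.\<close>

lemma pure_death_process_transition:
  assumes D: "pure_death_process M rate D"
    and rate: "inj rate" "rate 0 = 0" "\<And>k. k \<ge> 1 \<Longrightarrow> rate k > 0"
    and ts: "t \<ge> 0" "s \<ge> 0"
  shows "\<P>(\<omega> in M. D (t + s) \<omega> = r \<and> D t \<omega> = n) = \<P>(\<omega> in M. D t \<omega> = n) * death_trans rate n r s"
proof -
  interpret prob_space M using D by (simp add: pure_death_process_def)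
  obtain T where
    indep: "indep_vars (\<lambda>_. borel) (\<lambda>k. if k = 0 then (\<lambda>\<omega>. real (D 0 \<omega>)) else T k) UNIV" and
    distr: "\<And>k. k \<ge> 1 \<Longrightarrow> distributed M lborel (T k) (exponential_density (rate k))" and
    path: "AE \<omega> in M. \<forall>t\<ge>0. D t \<omega> = death_path (\<lambda>k. T k \<omega>) (D 0 \<omega>) t"
    using D unfolding pure_death_process_def by blast
  have D_meas [measurable]: "D u \<in> measurable M (count_space UNIV)" if "u \<ge> 0" for u
    using D that by (simp add: pure_death_process_def)
  have "indep_vars (\<lambda>_. borel) T {1..}"
    using indep_vars_subset[OF indep, of "{1..}"]
    by (rule indep_vars_cong[THEN iffD1, rotated -1]) auto
  then interpret death_chain M rate T
    by unfold_locales (use rate distr in auto)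
  \<comment> \<open>\<open>x\<close> and \<open>y\<close> stay free so that the same identity serves
    for the joint law (increment s) and for the law at time t alone (increment 0).\<close>
  have joint: "prob {\<omega> \<in> space M. D (t + x) \<omega> = y \<and> D t \<omega> = n \<and> D 0 \<omega> = N}
      = prob {\<omega> \<in> space M. D 0 \<omega> = N} * death_trans rate N n t * death_trans rate n y x"
    if "x \<ge> 0" for N x y
  proof -
    let ?A = "{h \<in> space (PiM {Suc 0..N} (\<lambda>_. borel)). death_path h N t = n \<and> death_path h N (t + x) = y}"
    have [measurable]: "(\<lambda>h. death_path h N u) \<in> measurable (PiM {Suc 0..N} (\<lambda>_. borel)) (count_space UNIV)" for u
      by (rule measurable_death_path) auto
    have A: "?A \<in> sets (PiM {Suc 0..N} (\<lambda>_. borel))" by measurable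
    let ?B = "{h \<in> space (PiM {0} (\<lambda>_. borel)). h 0 = real N}"
    have B: "?B \<in> sets (PiM {0 :: nat} (\<lambda>_. borel))" by measurable
    let ?X = "\<lambda>k. if k = 0 then (\<lambda>\<omega>. real (D 0 \<omega>)) else T k"
    have "indep_var (PiM {0} (\<lambda>_. borel)) (\<lambda>\<omega>. restrict (\<lambda>i. ?X i \<omega>) {0})
      (PiM {Suc 0..N} (\<lambda>_. borel)) (\<lambda>\<omega>. restrict (\<lambda>i. ?X i \<omega>) {Suc 0..N})"
      by (rule indep_var_restrict[OF indep]) auto
    moreover have "restrict (\<lambda>i. ?X i \<omega>) {Suc 0..N} = restrict (\<lambda>i. T i \<omega>) {Suc 0..N}" for \<omega>
      by (auto simp: restrict_def)
    ultimately have "indep_var (PiM {0} (\<lambda>_. borel)) (\<lambda>\<omega>. restrict (\<lambda>i. ?X i \<omega>) {0})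
        (PiM {Suc 0..N} (\<lambda>_. borel)) (\<lambda>\<omega>. restrict (\<lambda>i. T i \<omega>) {Suc 0..N})"
      by simp
    from indep_varD[OF this B A]
    have "prob ((\<lambda>\<omega>. (restrict (\<lambda>i. ?X i \<omega>) {0}, restrict (\<lambda>i. T i \<omega>) {Suc 0..N})) -` (?B \<times> ?A) \<inter> space M)
      = prob ((\<lambda>\<omega>. restrict (\<lambda>i. ?X i \<omega>) {0}) -` ?B \<inter> space M) *
        prob ((\<lambda>\<omega>. restrict (\<lambda>i. T i \<omega>) {Suc 0..N}) -` ?A \<inter> space M)" .
    also have "(\<lambda>\<omega>. restrict (\<lambda>i. ?X i \<omega>) {0}) -` ?B \<inter> space M = {\<omega> \<in> space M. D 0 \<omega> = N}"
      by (auto simp: space_PiM)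
    also have "(\<lambda>\<omega>. restrict (\<lambda>i. T i \<omega>) {Suc 0..N}) -` ?A \<inter> space M
      = {\<omega> \<in> space M. death_path (\<lambda>k. T k \<omega>) N t = n \<and> death_path (\<lambda>k. T k \<omega>) N (t + x) = y}"
      by (auto simp: death_path_restrict space_PiM)
    also have "prob \<dots> = death_trans rate N n t * death_trans rate n y x"
    proof -
      have "death_trans rate N n t * death_trans rate n y x \<ge> 0"
        using rate ts that by (intro mult_nonneg_nonneg death_trans_nonneg) (auto intro: less_imp_le)
      then show ?thesis
        using emeasure_death_path_pair[OF ts(1) that, of N n y]
        by (simp only: measure_def enn2real_ennreal)
    qed
    also have "prob ((\<lambda>\<omega>. (restrict (\<lambda>i. ?X i \<omega>) {0}, restrict (\<lambda>i. T i \<omega>) {Suc 0..N})) -` (?B \<times> ?A) \<inter> space M)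
      = prob {\<omega> \<in> space M. D 0 \<omega> = N \<and> death_path (\<lambda>k. T k \<omega>) N t = n \<and> death_path (\<lambda>k. T k \<omega>) N (t + x) = y}"
      by (rule arg_cong[where f = prob]) (auto simp: death_path_restrict space_PiM)
    also have "\<dots> = prob {\<omega> \<in> space M. D (t + x) \<omega> = y \<and> D t \<omega> = n \<and> D 0 \<omega> = N}"
    \<comment> \<open>\<open>D\<close> agrees with the constructed path only almost surely, so the
      two events may differ by a null set.\<close>
    proof (rule measure_eq_AE)
      show "AE \<omega> in M. \<omega> \<in> {\<omega> \<in> space M. D 0 \<omega> = N \<and> death_path (\<lambda>k. T k \<omega>) N t = n \<and> death_path (\<lambda>k. T k \<omega>) N (t + x) = y}
         \<longleftrightarrow> \<omega> \<in> {\<omega> \<in> space M. D (t + x) \<omega> = y \<and> D t \<omega> = n \<and> D 0 \<omega> = N}"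
        using path
      proof eventually_elim
        case (elim \<omega>)
        have "D t \<omega> = death_path (\<lambda>k. T k \<omega>) (D 0 \<omega>) t"
          "D (t + x) \<omega> = death_path (\<lambda>k. T k \<omega>) (D 0 \<omega>) (t + x)"
          using elim ts that by (meson add_nonneg_nonneg)+
        then show ?case by auto
      qed
      have "{\<omega> \<in> space M. D 0 \<omega> = N} \<inter> {\<omega> \<in> space M. death_path (\<lambda>k. T k \<omega>) N t = n \<and> death_path (\<lambda>k. T k \<omega>) N (t + x) = y} \<in> events"
        by (intro sets.Int death_path_pair_sets) measurable
      then show "{\<omega> \<in> space M. D 0 \<omega> = N \<and> death_path (\<lambda>k. T k \<omega>) N t = n \<and> death_path (\<lambda>k. T k \<omega>) N (t + x) = y} \<in> events"
        by (simp add: Int_def conj_ac)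
      have "D (t + x) \<in> measurable M (count_space UNIV)" "D t \<in> measurable M (count_space UNIV)"
        using ts that by auto
      then show "{\<omega> \<in> space M. D (t + x) \<omega> = y \<and> D t \<omega> = n \<and> D 0 \<omega> = N} \<in> events"
        by measurable
    qed
    finally show ?thesis by simp
  qed
  have sums: "(\<lambda>N. prob {\<omega> \<in> space M. D 0 \<omega> = N} * death_trans rate N n t * death_trans rate n y x)
      sums prob {\<omega> \<in> space M. D (t + x) \<omega> = y \<and> D t \<omega> = n}" if x: "x \<ge> 0" for x y
  proof -
    have [measurable]: "D (t + x) \<in> measurable M (count_space UNIV)" "D t \<in> measurable M (count_space UNIV)"
      using ts x by auto
    have "(\<lambda>N. prob {\<omega> \<in> space M. D (t + x) \<omega> = y \<and> D t \<omega> = n \<and> D 0 \<omega> = N})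
      sums prob (\<Union>N. {\<omega> \<in> space M. D (t + x) \<omega> = y \<and> D t \<omega> = n \<and> D 0 \<omega> = N})"
      by (rule finite_measure_UNION) (auto simp: disjoint_family_on_def)
    moreover have "(\<Union>N. {\<omega> \<in> space M. D (t + x) \<omega> = y \<and> D t \<omega> = n \<and> D 0 \<omega> = N})
      = {\<omega> \<in> space M. D (t + x) \<omega> = y \<and> D t \<omega> = n}" by auto
    ultimately show ?thesis by (simp add: joint[OF x])
  qed
  \<comment> \<open>Increment 0 and target \<open>n\<close> make the second condition repeat the
    first, which gives the series for the marginal law.\<close>
  have "(\<lambda>N. prob {\<omega> \<in> space M. D 0 \<omega> = N} * death_trans rate N n t) sums \<P>(\<omega> in M. D t \<omega> = n)"
    using sums[of 0 n] by simp
  from sums_mult2[OF this, of "death_trans rate n r s"] sums[OF ts(2), of r] show ?thesis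
    by (rule sums_unique2[symmetric])
qed

subsection \<open>Finite differences of rising factorials\<close>

text \<open>The operator (I - E)^N with E the unit shift, that is (-1)^N times the usual forward
  difference; this sign fits the alternating signs of d_m.\<close>

definition alt_diff :: "nat \<Rightarrow> (real \<Rightarrow> real) \<Rightarrow> real \<Rightarrow> real" where
  "alt_diff N f x = (\<Sum>j\<le>N. (-1) ^ j * real (N choose j) * f (x + real j))"

lemma alt_diff_0 [simp]: "alt_diff 0 f x = f x"
  by (simp add: alt_diff_def)

lemma alt_diff_Suc: "alt_diff (Suc N) f x = alt_diff N (\<lambda>x. f x - f (x + 1)) x"
proof -
  let ?g = "\<lambda>j. f (x + real j)"
  have "alt_diff (Suc N) f x
      = ?g 0 + (\<Sum>j\<le>N. (-1) ^ Suc j * real (N choose Suc j) * ?g (Suc j))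
        - (\<Sum>j\<le>N. (-1) ^ j * real (N choose j) * ?g (Suc j))"
    unfolding alt_diff_def sum.atMost_Suc_shift
    by (simp add: algebra_simps sum.distrib sum_subtractf sum_negf)
  also have "?g 0 + (\<Sum>j\<le>N. (-1) ^ Suc j * real (N choose Suc j) * ?g (Suc j))
      = (\<Sum>j\<le>Suc N. (-1) ^ j * real (N choose j) * ?g j)"
    unfolding sum.atMost_Suc_shift by simp
  also have "\<dots> = (\<Sum>j\<le>N. (-1) ^ j * real (N choose j) * ?g j)" by simp
  finally show ?thesis
    by (simp add: alt_diff_def algebra_simps sum_subtractf)
qed

lemma alt_diff_cong:
  assumes "\<And>j. j \<le> N \<Longrightarrow> f (x + real j) = g (y + real j)"
  shows "alt_diff N f x = alt_diff N g y"
  using assms unfolding alt_diff_def by (intro sum.cong) auto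

lemma alt_diff_cmult: "alt_diff N (\<lambda>x. c * f x) x = c * alt_diff N f x"
  by (simp add: alt_diff_def sum_distrib_left algebra_simps)

text \<open>One difference of a rising factorial of length p is -p times one of length p - 1 at the
  shifted point, so the degree drops until a constant is differenced.\<close>

lemma alt_diff_pochhammer_eq_0: "p < N \<Longrightarrow> alt_diff N (\<lambda>x. pochhammer x p) x = 0"
proof (induction N arbitrary: p x)
  case (Suc N)
  show ?case
  proof (cases p)
    case 0
    then show ?thesis by (simp only: alt_diff_Suc) (simp add: alt_diff_def)
  next
    case (Suc q)
    have "pochhammer y p - pochhammer (y + 1) p = - real p * pochhammer (y + 1) q" for y :: real
      using pochhammer_rec[of y q] pochhammer_rec'[of "y + 1" q] by (simp add: Suc algebra_simps)
    hence "alt_diff (Suc N) (\<lambda>x. pochhammer x p) x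
        = - real p * alt_diff N (\<lambda>x. pochhammer (x + 1) q) x"
      by (simp only: alt_diff_Suc alt_diff_cmult)
    also have "alt_diff N (\<lambda>x. pochhammer (x + 1) q) x = alt_diff N (\<lambda>x. pochhammer x q) (x + 1)"
      by (rule alt_diff_cong) (simp add: algebra_simps)
    finally show ?thesis using Suc.IH[of q "x + 1"] Suc.prems Suc by simp
  qed
qed simp

text \<open>Each difference lengthens the denominator by one factor and contributes its former
  length \<open>a\<close>, hence a(a+1)...(a+N-1). Positivity of \<open>x\<close> keeps all
  denominators nonzero.\<close>

lemma alt_diff_inverse_pochhammer:
  assumes "x > 0"
  shows "alt_diff N (\<lambda>x. 1 / pochhammer x a) x = pochhammer (real a) N / pochhammer x (a + N)"
proof (induction N arbitrary: a)
  case (Suc N)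
  have eq: "1 / pochhammer y a - 1 / pochhammer (y + 1) a = real a * (1 / pochhammer y (Suc a))"
    if "y > 0" for y :: real
  proof -
    have nz: "pochhammer y a > 0" "pochhammer (y + 1) a > 0" "y + real a > 0" using that
      by (auto intro!: pochhammer_pos)
    have "y * pochhammer (y + 1) a = pochhammer y a * (y + real a)"
      using pochhammer_rec[of y a] pochhammer_Suc[of y a] by simp
    hence "1 / pochhammer (y + 1) a = y / (pochhammer y a * (y + real a))"
      using nz that by (simp add: divide_simps mult_ac)
    hence "1 / pochhammer y a - 1 / pochhammer (y + 1) a
        = 1 / pochhammer y a - y / (pochhammer y a * (y + real a))" by simp
    also have "\<dots> = real a / (pochhammer y a * (y + real a))"
      using nz by (simp add: divide_simps)
    finally show ?thesis by (simp add: pochhammer_Suc)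
  qed
  have "alt_diff (Suc N) (\<lambda>x. 1 / pochhammer x a) x
      = alt_diff N (\<lambda>x. real a * (1 / pochhammer x (Suc a))) x"
    unfolding alt_diff_Suc using assms by (intro alt_diff_cong eq) auto
  also have "\<dots> = real a * (pochhammer (real (Suc a)) N / pochhammer x (Suc a + N))"
    using Suc.IH[of "Suc a"] by (simp only: alt_diff_cmult)
  also have "\<dots> = pochhammer (real a) (Suc N) / pochhammer x (a + Suc N)"
    by (simp add: pochhammer_rec[of "real a"] add.commute)
  finally show ?case .
qed simp

subsection \<open>The mixture of the functions \<open>d_m\<close>\<close>

lemma death_rate_diff:
  "death_rate \<theta> j - death_rate \<theta> k = (real j - real k) * (real j + real k - 1 + \<theta>) / 2"
  by (simp add: death_rate_def field_simps)

lemma death_rate_inj: "\<theta> > 0 \<Longrightarrow> inj (death_rate \<theta>)"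
proof (rule injI)
  fix j k :: nat assume "\<theta> > 0" "death_rate \<theta> j = death_rate \<theta> k"
  hence "(real j - real k) * (real j + real k - 1 + \<theta>) = 0"
    using death_rate_diff[of \<theta> j k] by simp
  moreover have "real j + real k - 1 + \<theta> \<noteq> 0" if "j \<noteq> k"
    using that \<open>\<theta> > 0\<close> by (cases j; cases k) auto
  ultimately show "j = k" by auto
qed

lemma prod_death_rate:
  assumes "r \<le> n"
  shows "(\<Prod>i\<in>{r<..n}. death_rate \<theta> i) * (2 ^ (n - r) * fact r * pochhammer \<theta> r)
     = fact n * pochhammer \<theta> n"
  using assms
proof (induction n rule: dec_induct)
  case (step n)
  have "{r<..Suc n} = insert (Suc n) {r<..n}" using step by auto
  moreover have "Suc n - r = Suc (n - r)" using step by simp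
  ultimately have "(\<Prod>i\<in>{r<..Suc n}. death_rate \<theta> i) * (2 ^ (Suc n - r) * fact r * pochhammer \<theta> r)
     = 2 * death_rate \<theta> (Suc n)
       * ((\<Prod>i\<in>{r<..n}. death_rate \<theta> i) * (2 ^ (n - r) * fact r * pochhammer \<theta> r))"
    by simp
  then show ?case
    unfolding step.IH by (simp add: death_rate_def pochhammer_Suc)
qed simp

text \<open>The prefactor is the factor j + k - 1 + \<theta> at j = k, so the rising factorial has
  no gap and length k - r + 1. The induction runs downwards in \<open>r\<close>, each step adding a
  factor at the lower end.\<close>

lemma prod_death_rate_diff_below:
  assumes "r \<le> k"
  shows "(2 * real k - 1 + \<theta>) * (\<Prod>j\<in>{r..<k}. death_rate \<theta> j - death_rate \<theta> k) * 2 ^ (k - r)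
     = (-1) ^ (k - r) * fact (k - r) * pochhammer (real r + real k - 1 + \<theta>) (k - r + 1)"
  using assms
proof (induction r rule: inc_induct)
  case (step r)
  have "{r..<k} = insert r {Suc r..<k}" and k: "k - r = Suc (k - Suc r)" using step by auto
  hence "(2 * real k - 1 + \<theta>) * (\<Prod>j\<in>{r..<k}. death_rate \<theta> j - death_rate \<theta> k) * 2 ^ (k - r)
    = (real r - real k) * (real r + real k - 1 + \<theta>) *
      ((2 * real k - 1 + \<theta>) * (\<Prod>j\<in>{Suc r..<k}. death_rate \<theta> j - death_rate \<theta> k) * 2 ^ (k - Suc r))"
    by (simp add: death_rate_diff)
  also have "\<dots> = (real r - real k) * (real r + real k - 1 + \<theta>) *
      ((-1) ^ (k - Suc r) * fact (k - Suc r) * pochhammer (real r + real k - 1 + \<theta> + 1) (k - r))"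
    using k by (simp only: step.IH) (simp add: algebra_simps)
  also have "\<dots> = (-1) ^ (k - r) * fact (k - r) * pochhammer (real r + real k - 1 + \<theta>) (k - r + 1)"
  proof -
    have "real (Suc (k - Suc r)) = real k - real r" using step by simp
    then show ?thesis unfolding k by (simp add: pochhammer_rec del: of_nat_Suc) (simp add: algebra_simps)
  qed
  finally show ?case .
qed simp

text \<open>The indices above \<open>k\<close> prolong the same rising factorial at its upper end
  and contribute (n-k)!; the index \<open>k\<close> itself is already accounted for by the
  prefactor.\<close>

lemma prod_death_rate_diff:
  assumes "r \<le> k" "k \<le> n"
  shows "(2 * real k - 1 + \<theta>) * (\<Prod>j\<in>{r..n} - {k}. death_rate \<theta> j - death_rate \<theta> k) * 2 ^ (n - r)
     = (-1) ^ (k - r) * fact (k - r) * fact (n - k)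
       * pochhammer (real r + real k - 1 + \<theta>) (n - r + 1)"
  using assms(2)
proof (induction n rule: dec_induct)
  case base
  have "{r..k} - {k} = {r..<k}" by auto
  then show ?case using prod_death_rate_diff_below[OF assms(1)] by simp
next
  case (step n)
  have "{r..Suc n} - {k} = insert (Suc n) ({r..n} - {k})" using step assms by auto
  hence "(2 * real k - 1 + \<theta>) * (\<Prod>j\<in>{r..Suc n} - {k}. death_rate \<theta> j - death_rate \<theta> k)
      * 2 ^ (Suc n - r)
    = (real (Suc n) - real k) * (real n + real k + \<theta>) *
     ((2 * real k - 1 + \<theta>) * (\<Prod>j\<in>{r..n} - {k}. death_rate \<theta> j - death_rate \<theta> k) * 2 ^ (n - r))"
  proof -
    have "Suc n - r = Suc (n - r)" using step assms by simp
    then show ?thesis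
      using \<open>{r..Suc n} - {k} = insert (Suc n) ({r..n} - {k})\<close> by (simp add: death_rate_diff)
  qed
  also have "\<dots> = (-1) ^ (k - r) * fact (k - r) * fact (Suc n - k)
       * pochhammer (real r + real k - 1 + \<theta>) (Suc n - r + 1)"
  proof -
    have "real (Suc (n - k)) = real (Suc n) - real k" "Suc n - k = Suc (n - k)" 
      "Suc n - r + 1 = Suc (n - r + 1)" using step assms by auto
    moreover have "real r + real k - 1 + \<theta> + real (n - r + 1) = real n + real k + \<theta>"
      using step assms by auto
    ultimately show ?thesis unfolding step.IH
      by (simp only: pochhammer_Suc fact_Suc mult_ac)
  qed
  finally show ?case .
qed

(* The term m = k = 0 accounts for the isolated 1 in d_0; elsewhere this is the paper's summand,
   so that d_m is the sum of d_term over all k >= m. *)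
definition d_term :: "real \<Rightarrow> real \<Rightarrow> nat \<Rightarrow> nat \<Rightarrow> real" where
  "d_term \<theta> s m k = (if k = 0 then 1 else
     (-1) ^ (k - m) * real (k choose m) * pochhammer (\<theta> + real m) (k - 1) / fact k
       * gamma_coeff k s \<theta>)"

definition mix_coeff :: "real \<Rightarrow> nat \<Rightarrow> nat \<Rightarrow> nat \<Rightarrow> real" where
  "mix_coeff \<theta> n r m = real (m choose r) * (pochhammer \<theta> m / pochhammer \<theta> (n + m))"

text \<open>Summability is a hypothesis here because it comes out later from absolute convergence of
  the double series. For \<open>m = 0\<close> the leading 1 is the term of index 0, and the shift by
  one absorbs the minus sign.\<close>

lemma d_fun_sums:
  assumes "summable (\<lambda>i. d_term \<theta> s m (m + i))"
  shows "(\<lambda>i. d_term \<theta> s m (m + i)) sums d_fun \<theta> m s"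
proof (cases "m = 0")
  case False
  then have "d_fun \<theta> m s = (\<Sum>i. d_term \<theta> s m (m + i))"
    by (simp add: d_fun_def d_term_def)
  then show ?thesis using assms by (simp add: summable_sums)
next
  case True
  let ?f = "\<lambda>i. d_term \<theta> s 0 i"
  have "summable ?f" using assms True by simp
  hence sm: "summable (\<lambda>i. ?f (Suc i))" by (subst summable_Suc_iff)
  have neg: "?f (Suc i) = - ((-1) ^ i * pochhammer \<theta> i * (1 / fact (i + 1)) * gamma_coeff (i + 1) s \<theta>)"
    for i by (simp add: d_term_def)
  have "(\<lambda>i. ?f (Suc i)) sums
      - (\<Sum>k. (-1) ^ k * pochhammer \<theta> k * (1 / fact (k + 1)) * gamma_coeff (k + 1) s \<theta>)"
    using sm unfolding neg by (auto simp: summable_minus_iff intro!: sums_minus summable_sums)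
  hence "?f sums (- (\<Sum>k. (-1) ^ k * pochhammer \<theta> k * (1 / fact (k + 1)) * gamma_coeff (k + 1) s \<theta>) + ?f 0)"
    by (subst (asm) sums_Suc_iff) simp
  then show ?thesis using True by (simp add: d_fun_def d_term_def)
qed

section \<open>Bounds for absolute convergence of the double series\<close>

lemma pochhammer_le_power:
  fixes x :: real
  assumes "x \<ge> 0"
  shows "pochhammer x k \<le> (x + real k) ^ k"
proof -
  have "pochhammer x k \<le> (\<Prod>i<k. x + real k)"
    unfolding pochhammer_prod atLeast0LessThan using assms by (intro prod_mono) auto
  then show ?thesis by simp
qed

lemma pochhammer_mono:
  fixes x y :: real
  assumes "0 \<le> x" "x \<le> y"
  shows "pochhammer x k \<le> pochhammer y k"
  unfolding pochhammer_prod using assms by (intro prod_mono) auto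

lemma choose_le_power2: "n choose k \<le> 2 ^ n"
proof (cases "k \<le> n")
  case True
  have "n choose k \<le> (\<Sum>i\<le>n. n choose i)" using True by (intro member_le_sum) auto
  then show ?thesis by (simp add: choose_row_sum)
qed (simp add: binomial_eq_0)

text \<open>Product of the bounds in \<open>mix_coeff_le\<close> and \<open>d_term_le\<close>, free
  of m, so that summing over m at fixed k costs at most a factor k + 1. The term 2k + 1 + \<theta>
  replaces 2k - 1 + \<theta> to stay valid at k = 0, where \<open>d_term\<close> is 1.\<close>

definition term_bound :: "real \<Rightarrow> real \<Rightarrow> nat \<Rightarrow> nat \<Rightarrow> real" where
  "term_bound \<theta> s n k = 2 ^ k / pochhammer \<theta> n * (2 ^ k * (\<theta> + 2 * real k) ^ k
     * ((2 * real k + 1 + \<theta>) * exp (- death_rate \<theta> k * s)))"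

lemma mix_coeff_nonneg: "\<theta> > 0 \<Longrightarrow> mix_coeff \<theta> n r m \<ge> 0"
  by (simp add: mix_coeff_def pochhammer_nonneg)

lemma mix_coeff_le:
  assumes "\<theta> > 0" "m \<le> k"
  shows "mix_coeff \<theta> n r m \<le> 2 ^ k / pochhammer \<theta> n"
proof -
  have "m choose r \<le> 2 ^ k"
    using choose_le_power2[of m r] power_increasing[of m k "2 :: nat"] assms by linarith
  hence c: "real (m choose r) \<le> 2 ^ k" by (simp flip: of_nat_le_iff)
  have "pochhammer \<theta> (n + m) = pochhammer \<theta> m * pochhammer (\<theta> + real m) n"
    by (simp add: pochhammer_product'[symmetric] add.commute)
  hence "pochhammer \<theta> m / pochhammer \<theta> (n + m) = 1 / pochhammer (\<theta> + real m) n"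
    using pochhammer_pos[OF assms(1), of m] by simp
  also have "\<dots> \<le> 1 / pochhammer \<theta> n"
    using assms by (intro divide_left_mono pochhammer_mono mult_pos_pos pochhammer_pos) auto
  finally show ?thesis
    unfolding mix_coeff_def using mult_mono[OF c] assms
    by (fastforce simp: pochhammer_nonneg)
qed

lemma d_term_le:
  assumes "\<theta> > 0" "m \<le> k"
  shows "\<bar>d_term \<theta> s m k\<bar> \<le> 2 ^ k * (\<theta> + 2 * real k) ^ k
     * ((2 * real k + 1 + \<theta>) * exp (- death_rate \<theta> k * s))"
proof (cases "k = 0")
  case True
  then show ?thesis using assms by (simp add: d_term_def death_rate_def)
next
  case False
  have c: "real (k choose m) \<le> 2 ^ k"
    using choose_le_power2[of k m] by (simp flip: of_nat_le_iff)
  have "pochhammer (\<theta> + real m) (k - 1) \<le> (\<theta> + real m + real (k - 1)) ^ (k - 1)"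
    using assms by (intro pochhammer_le_power) auto
  also have "\<dots> \<le> (\<theta> + 2 * real k) ^ (k - 1)"
    using assms by (intro power_mono) auto
  \<comment> \<open>Raising the exponent needs a base of at least 1, which holds because k is
    positive.\<close>
  also have "\<dots> \<le> (\<theta> + 2 * real k) ^ k"
    using assms False by (intro power_increasing) auto
  finally have p: "pochhammer (\<theta> + real m) (k - 1) \<le> (\<theta> + 2 * real k) ^ k" .
  have p': "pochhammer (\<theta> + real m) (k - 1) / fact k \<le> (\<theta> + 2 * real k) ^ k"
    using p divide_left_mono[of 1 "fact k" "pochhammer (\<theta> + real m) (k - 1)"] assms
    by (auto intro: order_trans simp: pochhammer_nonneg)
  have g: "\<bar>gamma_coeff k s \<theta>\<bar> \<le> (2 * real k + 1 + \<theta>) * exp (- death_rate \<theta> k * s)"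
    unfolding gamma_coeff_def abs_mult using assms by (intro mult_mono) auto
  have "\<bar>d_term \<theta> s m k\<bar> = real (k choose m) * (pochhammer (\<theta> + real m) (k - 1) / fact k)
      * \<bar>gamma_coeff k s \<theta>\<bar>"
    using False assms by (simp add: d_term_def abs_mult pochhammer_nonneg power_abs)
  also have "\<dots> \<le> 2 ^ k * (\<theta> + 2 * real k) ^ k
     * ((2 * real k + 1 + \<theta>) * exp (- death_rate \<theta> k * s))"
    using assms by (intro mult_mono c p' g) (auto intro!: pochhammer_nonneg divide_nonneg_nonneg)
  finally show ?thesis .
qed

text \<open>The quadratic exponent beats k^k = exp(k log k) and every geometric factor, so the ratio
  1/2 of the majorant is an arbitrary choice.\<close>

lemma term_bound_summable:
  assumes "\<theta> > 0" "s > 0"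
  shows "summable (\<lambda>k. real (Suc k) * term_bound \<theta> s n k)"
proof (rule summable_comparison_test_bigo)
  show "summable (\<lambda>k. norm ((1 / 2) ^ k :: real))" by (simp add: summable_geometric)
  have "(\<lambda>k. real (Suc k) * (2 ^ k * (2 ^ k * (\<theta> + 2 * real k) ^ k
     * ((2 * real k + 1 + \<theta>) * exp (- (real k * (real k - 1 + \<theta>) / 2) * s))))) \<in> O(\<lambda>k. (1 / 2) ^ k)"
    using assms by real_asymp
  then show "(\<lambda>k. real (Suc k) * term_bound \<theta> s n k) \<in> O(\<lambda>k. (1 / 2) ^ k)"
    using pochhammer_pos[OF assms(1), of n]
    by (simp add: term_bound_def death_rate_def)
qed

section \<open>Summation over m at a fixed exponent\<close>

lemma mix_coeff_d_term:
  assumes "r \<le> k" "k > 0" "j \<le> k - r"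
  shows "mix_coeff \<theta> n r (r + j) * d_term \<theta> s (r + j) k
    = (-1) ^ (k - r) * real (k choose r) / fact k * gamma_coeff k s \<theta>
      * ((-1) ^ j * real ((k - r) choose j)
         * (pochhammer \<theta> (r + j) / pochhammer \<theta> (n + (r + j)) * pochhammer (\<theta> + real (r + j)) (k - 1)))"
proof -
  \<comment> \<open>Trinomial revision: the dependence on j is concentrated in C(k-r,j), the weight
    of a difference of order k - r.\<close>
  have C: "real ((r + j) choose r) * real (k choose (r + j)) = real (k choose r) * real ((k - r) choose j)"
    using choose_mult[of r "r + j" k] assms by (simp flip: of_nat_mult add: mult.commute)
  have "k - r = k - (r + j) + j" using assms by simp
  hence S: "(-1 :: real) ^ (k - (r + j)) = (-1) ^ (k - r) * (-1) ^ j"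
    by (simp add: power_add flip: power_mult_distrib)
  have "mix_coeff \<theta> n r (r + j) * d_term \<theta> s (r + j) k
     = (-1) ^ (k - (r + j)) * (real ((r + j) choose r) * real (k choose (r + j)))
       * (pochhammer \<theta> (r + j) / pochhammer \<theta> (n + (r + j)) * pochhammer (\<theta> + real (r + j)) (k - 1))
       * (1 / fact k * gamma_coeff k s \<theta>)"
    using assms by (simp add: mix_coeff_def d_term_def)
  then show ?thesis unfolding C S by (simp add: mult_ac)
qed

text \<open>The rising factorials cancel down to one of length p = k - 1 - n, and p < k - r because
  r is at most n.\<close>

lemma mix_sum_eq_0:
  assumes "\<theta> > 0" "r \<le> n" "n < k"
  shows "(\<Sum>j\<le>k - r. mix_coeff \<theta> n r (r + j) * d_term \<theta> s (r + j) k) = 0"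
proof -
  define p where "p = k - 1 - n"
  define c where "c = (-1) ^ (k - r) * real (k choose r) / fact k * gamma_coeff k s \<theta>"
  have "mix_coeff \<theta> n r (r + j) * d_term \<theta> s (r + j) k
     = c * ((-1) ^ j * real ((k - r) choose j) * pochhammer (\<theta> + real n + real r + real j) p)"
    if j: "j \<le> k - r" for j
  proof -
    have "pochhammer \<theta> (r + j) * pochhammer (\<theta> + real (r + j)) (k - 1) = pochhammer \<theta> (n + (r + j) + p)"
      using assms by (subst pochhammer_product'[symmetric]) (simp add: p_def add.assoc)
    also have "\<dots> = pochhammer \<theta> (n + (r + j)) * pochhammer (\<theta> + real n + real r + real j) p"
      by (subst pochhammer_product') (simp add: algebra_simps)
    finally have P: "pochhammer \<theta> (r + j) / pochhammer \<theta> (n + (r + j)) * pochhammer (\<theta> + real (r + j)) (k - 1)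
       = pochhammer (\<theta> + real n + real r + real j) p"
      using pochhammer_pos[OF assms(1), of "n + (r + j)"] by (simp add: field_simps)
    show ?thesis
      using mix_coeff_d_term[of r k j \<theta> n s] assms j unfolding P c_def by simp
  qed
  hence "(\<Sum>j\<le>k - r. mix_coeff \<theta> n r (r + j) * d_term \<theta> s (r + j) k)
     = c * alt_diff (k - r) (\<lambda>x. pochhammer x p) (\<theta> + real n + real r)"
    by (simp add: alt_diff_def sum_distrib_left)
  also have "\<dots> = 0" using assms by (subst alt_diff_pochhammer_eq_0) (auto simp: p_def)
  finally show ?thesis .
qed

lemma mix_sum_eq:
  assumes "\<theta> > 0" "r \<le> k" "k \<le> n" "k > 0"
  shows "(\<Sum>j\<le>k - r. mix_coeff \<theta> n r (r + j) * d_term \<theta> s (r + j) k)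
    = (-1) ^ (k - r) * fact (n - r) * gamma_coeff k s \<theta>
      / (fact r * fact (k - r) * fact (n - k) * pochhammer (\<theta> + real r + real k - 1) (n - r + 1))"
proof -
  \<comment> \<open>\<open>a\<close> counts the denominator factors that survive the cancellation
    and \<open>x\<close> is the first of them at j = 0; a + (k - r) = n - r + 1 is the final
    length.\<close>
  define a where "a = n - k + 1"
  define c where "c = (-1) ^ (k - r) * real (k choose r) / fact k * gamma_coeff k s \<theta>"
  define x where "x = \<theta> + real r + real k - 1"
  have x: "x > 0" using assms by (simp add: x_def)
  have "mix_coeff \<theta> n r (r + j) * d_term \<theta> s (r + j) k
     = c * ((-1) ^ j * real ((k - r) choose j) * (1 / pochhammer (x + real j) a))"
    if j: "j \<le> k - r" for j
  proof -
    have "pochhammer \<theta> (n + (r + j)) = pochhammer \<theta> (r + j + (k - 1) + a)"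
      using assms by (simp add: a_def algebra_simps)
    also have "\<dots> = pochhammer \<theta> (r + j) * pochhammer (\<theta> + real (r + j)) (k - 1) * pochhammer (x + real j) a"
      unfolding pochhammer_product' x_def using assms by (simp add: algebra_simps of_nat_diff)
    finally have P: "pochhammer \<theta> (r + j) / pochhammer \<theta> (n + (r + j)) * pochhammer (\<theta> + real (r + j)) (k - 1)
       = 1 / pochhammer (x + real j) a"
      using pochhammer_pos[OF assms(1), of "r + j"] pochhammer_pos[of "\<theta> + real (r + j)" "k - 1"] assms
      by (simp add: field_simps)
    show ?thesis
      using mix_coeff_d_term[of r k j \<theta> n s] assms j unfolding P c_def by simp
  qed
  hence "(\<Sum>j\<le>k - r. mix_coeff \<theta> n r (r + j) * d_term \<theta> s (r + j) k)
     = c * alt_diff (k - r) (\<lambda>x. 1 / pochhammer x a) x"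
    by (simp add: alt_diff_def sum_distrib_left)
  also have "\<dots> = c * (pochhammer (real a) (k - r) / pochhammer x (n - r + 1))"
    using assms by (simp add: alt_diff_inverse_pochhammer[OF x] a_def)
  also have "pochhammer (real a) (k - r) = fact (n - r) / fact (n - k)"
  proof -
    have "n - k + (k - r) = n - r" using assms by simp
    then have "(fact (n - r) :: real) = fact (n - k) * pochhammer (real a) (k - r)"
      using pochhammer_product'[of "1 :: real" "n - k" "k - r"]
      by (simp add: pochhammer_fact a_def add.commute)
    then show ?thesis by simp
  qed
  also have "c = (-1) ^ (k - r) / (fact r * fact (k - r)) * gamma_coeff k s \<theta>"
    using assms by (simp add: c_def binomial_fact)
  finally show ?thesis by (simp add: x_def mult_ac)
qed

lemma death_trans_term:
  assumes "\<theta> > 0" "r \<le> k" "k \<le> n"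
  shows "(\<Sum>j\<le>k - r. mix_coeff \<theta> n r (r + j) * d_term \<theta> s (r + j) k)
    = pochhammer \<theta> r * fact (n - r) / (pochhammer \<theta> n * fact n) *
      ((\<Prod>i\<in>{r<..n}. death_rate \<theta> i) *
       (exp (- death_rate \<theta> k * s) / (\<Prod>j\<in>{r..n} - {k}. death_rate \<theta> j - death_rate \<theta> k)))"
proof (cases "k = 0")
  case True
  \<comment> \<open>Here r = 0, and the \<open>x\<close> of \<open>mix_sum_eq\<close> would be
    \<theta> - 1, possibly not positive. Since the rate of state 0 vanishes, the denominator is the
    product of the rates and cancels; both sides are the reciprocal of
    \<open>pochhammer \<theta> n\<close>.\<close>
  have "{0..n} - {0} = {0<..n}" by auto
  moreover have "(\<Prod>i\<in>{0<..n}. death_rate \<theta> i) \<noteq> 0"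
    using assms by (auto simp: death_rate_def)
  ultimately show ?thesis
    using True assms by (simp add: mix_coeff_def d_term_def death_rate_def)
next
  case False
  define A where "A = (\<Prod>i\<in>{r<..n}. death_rate \<theta> i)"
  define W where "W = (\<Prod>j\<in>{r..n} - {k}. death_rate \<theta> j - death_rate \<theta> k)"
  define Q where "Q = pochhammer (\<theta> + real r + real k - 1) (n - r + 1)"
  define e where "e = exp (- death_rate \<theta> k * s)"
  define g where "g = 2 * real k - 1 + \<theta>"
  have pos: "pochhammer \<theta> r > 0" "pochhammer \<theta> n > 0" "Q > 0" "g > 0"
    unfolding Q_def g_def using assms False by (auto intro!: pochhammer_pos)
  have A: "A * (2 ^ (n - r) * fact r * pochhammer \<theta> r) = fact n * pochhammer \<theta> n"
    using prod_death_rate assms by (simp add: A_def)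
  have "g * W * 2 ^ (n - r) = (-1) ^ (k - r) * fact (k - r) * fact (n - k) * Q"
    using prod_death_rate_diff[of r k n \<theta>] assms by (simp add: g_def W_def Q_def algebra_simps)
  hence W: "W = (-1) ^ (k - r) * fact (k - r) * fact (n - k) * Q / (g * 2 ^ (n - r))"
    using pos by (simp add: field_simps)
  have A': "A = fact n * pochhammer \<theta> n / (2 ^ (n - r) * fact r * pochhammer \<theta> r)"
    using A pos by (simp add: field_simps)
  have "(-1) ^ (k - r) * fact (n - r) * (g * e) / (fact r * fact (k - r) * fact (n - k) * Q)
     = pochhammer \<theta> r * fact (n - r) / (pochhammer \<theta> n * fact n) * (A * (e / W))"
    \<comment> \<open>The sign moves from the denominator \<open>W\<close> to the numerator; it is
      its own inverse, which the parity split makes explicit.\<close>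
    unfolding W A' using pos by (cases "even (k - r)") (simp_all add: field_simps)
  then show ?thesis
    using mix_sum_eq[OF assms, of s] False
    by (simp add: gamma_coeff_def A_def W_def Q_def e_def g_def)
qed

text \<open>Starting the index at m = r loses nothing, as C(m,r) = 0 below, and makes every
  coefficient nonzero. Unconditional sums over index sets carry the interchange of
  summations.\<close>

lemma mix_sums_death_trans:
  assumes "\<theta> > 0" "s > 0" "r \<le> n"
  shows "(\<lambda>k. mix_coeff \<theta> n r (r + k) * d_fun \<theta> (r + k) s)
     sums (pochhammer \<theta> r * fact (n - r) / (pochhammer \<theta> n * fact n)
             * death_trans (death_rate \<theta>) n r s)"
proof -
  \<comment> \<open>One array in two coordinates: \<open>f\<close> is indexed by row m = r + j and
    offset i = k - m, while \<open>g\<close> uses p = k - r and ranges over the triangle j \<le> p.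
    The sums \<open>b\<close> are those at fixed k.\<close>
  define f where "f = (\<lambda>(j, i). mix_coeff \<theta> n r (r + j) * d_term \<theta> s (r + j) (r + j + i))"
  define g where "g = (\<lambda>(p, j). mix_coeff \<theta> n r (r + j) * d_term \<theta> s (r + j) (r + p))"
  define b where "b = (\<lambda>p. \<Sum>j\<le>p. g (p, j))"
  have bound: "\<bar>g (p, j)\<bar> \<le> term_bound \<theta> s n (r + p)" if "j \<le> p" for p j
    unfolding g_def prod.case abs_mult term_bound_def
    using that assms mix_coeff_nonneg[of \<theta> n r "r + j"] mix_coeff_le[of \<theta> "r + j" "r + p" n r]
      d_term_le[of \<theta> "r + j" "r + p" s]
    by (intro mult_mono) (auto intro!: divide_nonneg_nonneg pochhammer_nonneg)
  have "summable (\<lambda>p. real (Suc (p + r)) * term_bound \<theta> s n (p + r))"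
    using summable_ignore_initial_segment[OF term_bound_summable[OF assms(1,2)], of r n] by simp
  hence "summable (\<lambda>p. \<Sum>j\<le>p. norm (g (p, j)))"
  proof (rule summable_comparison_test'[where N = 0])
    fix p :: nat
    have "(\<Sum>j\<le>p. norm (g (p, j))) \<le> real (Suc p) * term_bound \<theta> s n (r + p)"
      using sum_bounded_above[of "{..p}" "\<lambda>j. norm (g (p, j))"] bound by simp
    also have "\<dots> \<le> real (Suc (p + r)) * term_bound \<theta> s n (p + r)"
      using bound[of 0 p] by (intro mult_mono) (auto simp: add.commute)
    finally show "norm (\<Sum>j\<le>p. norm (g (p, j))) \<le> \<dots>" by (simp add: sum_nonneg)
  qed
  hence "(\<lambda>p. norm (\<Sum>\<^sub>\<infinity>j\<in>{..p}. norm (g (p, j)))) summable_on UNIV"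
    by (simp add: summable_on_UNIV_nonneg_real_iff sum_nonneg)
  hence g_abs: "(\<lambda>x. norm (g x)) summable_on Sigma UNIV (\<lambda>p. {..p})"
    by (subst Infinite_Sum.abs_summable_on_Sigma_iff) auto
  then obtain S where S: "(g has_sum S) (Sigma UNIV (\<lambda>p. {..p}))"
    using abs_summable_summable summable_on_def by blast
  have bS: "(b has_sum S) UNIV"
    by (rule has_sum_SigmaD[OF S]) (auto simp: b_def intro: has_sum_finite)
  have b0: "b p = 0" if "p > n - r" for p
    using mix_sum_eq_0[of \<theta> r n "r + p" s] assms that by (simp add: b_def g_def)
  have "(b has_sum (\<Sum>p\<le>n - r. b p)) UNIV"
    using b0 has_sum_finite[of "{..n - r}" b]
    by (subst has_sum_cong_neutral[where T = "{..n - r}" and g = b]) auto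
  hence "S = (\<Sum>p\<le>n - r. b p)" using bS has_sum_unique by blast
  also have "\<dots> = (\<Sum>k\<in>{r..n}. b (k - r))"
    by (rule sum.reindex_bij_witness[of _ "\<lambda>k. k - r" "\<lambda>p. p + r"]) (use assms in auto)
  also have "\<dots> = pochhammer \<theta> r * fact (n - r) / (pochhammer \<theta> n * fact n)
             * death_trans (death_rate \<theta>) n r s"
    unfolding death_trans_def sum_distrib_left
  proof (rule sum.cong)
    fix k assume "k \<in> {r..n}"
    then show "b (k - r) = pochhammer \<theta> r * fact (n - r) / (pochhammer \<theta> n * fact n) *
      ((\<Prod>i\<in>{r<..n}. death_rate \<theta> i) *
       (exp (- death_rate \<theta> k * s) / (\<Prod>j\<in>{r..n} - {k}. death_rate \<theta> j - death_rate \<theta> k)))"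
      using death_trans_term[of \<theta> r k n s] assms by (simp add: b_def g_def)
  qed simp
  finally have S_eq: "S = \<dots>" .
  have bij: "bij_betw (\<lambda>(j, i). (j + i, j)) UNIV (Sigma UNIV (\<lambda>p. {..p :: nat}))"
    by (rule bij_betwI[of _ _ _ "\<lambda>(p, j). (j, p - j)"]) auto
  have f_g: "f = (\<lambda>x. g ((\<lambda>(j, i). (j + i, j)) x))"
    by (auto simp: f_def g_def fun_eq_iff add.assoc)
  have f_sum: "(f has_sum S) (Sigma UNIV (\<lambda>_. UNIV))"
    unfolding f_g using has_sum_reindex_bij_betw[OF bij, of g S] S by simp
  have f_abs': "(\<lambda>x. norm (f x)) summable_on UNIV"
    unfolding f_g using summable_on_reindex_bij_betw[OF bij, of "\<lambda>x. norm (g x)"] g_abs by simp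
  hence f_abs: "(\<lambda>i. norm (f (j, i))) summable_on UNIV" for j
    using Infinite_Sum.abs_summable_on_Sigma_iff[of f UNIV "\<lambda>_. UNIV"] by simp
  have "((\<lambda>i. f (j, i)) has_sum mix_coeff \<theta> n r (r + j) * d_fun \<theta> (r + j) s) UNIV" for j
  proof -
    \<comment> \<open>Since the coefficient is nonzero, summability of the weighted row gives that
      of the series for d_m itself.\<close>
    have c: "mix_coeff \<theta> n r (r + j) \<noteq> 0"
      using pochhammer_pos[OF assms(1), of "r + j"] pochhammer_pos[OF assms(1), of "n + (r + j)"]
      by (simp add: mix_coeff_def)
    have f_norm: "summable (\<lambda>i. norm (f (j, i)))"
      using f_abs by (simp add: summable_on_UNIV_nonneg_real_iff)
    hence "summable (\<lambda>i. f (j, i))" by (rule summable_norm_cancel)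
    hence "summable (\<lambda>i. d_term \<theta> s (r + j) (r + j + i))"
      using c by (simp add: f_def summable_cmult_iff)
    hence "(\<lambda>i. f (j, i)) sums (mix_coeff \<theta> n r (r + j) * d_fun \<theta> (r + j) s)"
      unfolding f_def prod.case by (intro sums_mult d_fun_sums)
    then show ?thesis using f_norm by (rule norm_summable_imp_has_sum[rotated])
  qed
  hence "((\<lambda>j. mix_coeff \<theta> n r (r + j) * d_fun \<theta> (r + j) s) has_sum S) UNIV"
    by (intro has_sum_SigmaD[OF f_sum]) auto
  then show ?thesis unfolding S_eq by (rule has_sum_imp_sums)
qed

theorem mainTheorem2:
  fixes \<theta> s t :: real and r n :: nat
    and M :: "'a measure" and D :: "real \<Rightarrow> 'a \<Rightarrow> nat"
  assumes "\<theta> > 0" and "s > 0" and "r \<le> n"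
    and "pure_death_process M (death_rate \<theta>) D"
    and "t \<ge> 0" and "\<P>(\<omega> in M. D t \<omega> = n) > 0"
  shows "(\<lambda>k. real ((r + k) choose r)
              * (pochhammer \<theta> (r + k) / pochhammer \<theta> (n + (r + k)))
              * d_fun \<theta> (r + k) s)
         sums (pochhammer \<theta> r * fact (n - r) / (pochhammer \<theta> n * fact n)
              * \<P>(\<omega> in M. D (t + s) \<omega> = r \<bar> D t \<omega> = n))"
proof -
  let ?q = "death_trans (death_rate \<theta>) n r s"
  have "\<P>(\<omega> in M. D (t + s) \<omega> = r \<and> D t \<omega> = n) = \<P>(\<omega> in M. D t \<omega> = n) * ?q"
    by (rule pure_death_process_transition[OF assms(4) death_rate_inj[OF assms(1)]])
       (use assms in \<open>auto simp: death_rate_def\<close>)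
  \<comment> \<open>Positive probability of the conditioning event permits the division; otherwise
    \<open>cond_prob\<close> would take the default value 0.\<close>
  hence "\<P>(\<omega> in M. D (t + s) \<omega> = r \<bar> D t \<omega> = n) = ?q"
    using assms(6) by (simp add: cond_prob_def)
  then show ?thesis
    using mix_sums_death_trans[OF assms(1-3)] by (simp add: mix_coeff_def)
qed

end
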